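(* Let $\beta\in[1,2]$ and let $f\in C[0,1]$ satisfy $f(x)\neq0$ for all $x\in[0,1]$. Then there exist $g,h\in C[0,1]$ such that $$f=g\cdot h\quad\text{and}\quad \overline{\dim}_B G(g)=\overline{\dim}_B G(h)=\beta$$ if and only if $\overline{\dim}_B G(f)\le\beta$.
   Context: $C[0,1]$ is the space of real-valued continuous functions on $[0,1]$; $G(h)=\{(x,h(x)):x\in[0,1]\}\subset\mathbb{R}^2$ is the graph of $h$; $g\cdot h$ is the pointwise product. For a nonempty bounded set $F$, $N_\delta(F)$ is the smallest number of sets of diameter at most $\delta$ covering $F$, and $\overline{\dim}_B F=\limsup_{\delta\to0}\frac{\log N_\delta(F)}{-\log\delta}$. *)

theory Defs
  imports "HOL-Analysis.Analysis"
begin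

text \<open>Graph of a function on [0,1], as a subset of the Euclidean plane (real * real carries
the Euclidean metric).\<close>
definition graph01 :: "(real \<Rightarrow> real) \<Rightarrow> (real \<times> real) set" where
  "graph01 h = (\<lambda>x. (x, h x)) ` {0..1}"

text \<open>N_delta(F): the smallest number of sets of diameter at most delta covering F.
Covering sets are required to be bounded so that diameter is meaningful.\<close>
definition cover_num :: "'a::metric_space set \<Rightarrow> real \<Rightarrow> nat" where
  "cover_num F \<delta> = (LEAST n. \<exists>U :: nat \<Rightarrow> 'a set.
      F \<subseteq> (\<Union>i<n. U i) \<and> (\<forall>i<n. bounded (U i) \<and> diameter (U i) \<le> \<delta>))"

definition upper_box_dim :: "'a::metric_space set \<Rightarrow> ereal" where
  "upper_box_dim F = Limsup (at_right 0) (\<lambda>\<delta>. ereal (ln (real (cover_num F \<delta>)) / - ln \<delta>))"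

end

theory Submission
  imports Defs "HOL-Real_Asymp.Real_Asymp"
begin

text \<open>Cut [0,1] into n equal cells and let \<open>osc_sum h n\<close> be the sum of the oscillations of h over
them. Up to constants, n times (\<open>osc_sum h n\<close> + 1) squares of side 1/n cover the graph of h, and no
cover by sets of diameter 1/n is substantially smaller. Hence the dimension of the graph is
governed by the growth of \<open>osc_sum h n\<close>, and a function whose increments are dominated by those of g
and h has a graph of dimension at most the maximum of the two. This covers products and, away from
zero, quotients and square roots.

The forward direction is the product bound. Conversely, if the graph of f has dimension exactly
\<open>\<beta>\<close>, then the square root of the absolute value of f, together with its product by the constant sign
of f, is a factorization. If the dimension is smaller, take g to be 1 plus a Takagi function of
dimension \<open>\<beta>\<close> and put h = f / g: as g = f / h too, h must have dimension \<open>\<beta>\<close>.\<close>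

subsection \<open>Box dimension and oscillation sums\<close>

lemma finite_cover_reindex:
  assumes "finite I" "F \<subseteq> (\<Union>i\<in>I. U i)" "\<And>i. i \<in> I \<Longrightarrow> P (U i)"
  shows "\<exists>W::nat \<Rightarrow> _. F \<subseteq> (\<Union>i<card I. W i) \<and> (\<forall>i<card I. P (W i))"
proof -
  obtain e where "bij_betw e {..<card I} I"
    using ex_bij_betw_nat_finite[OF assms(1)] by (auto simp: atLeast0LessThan)
  then have e: "e ` {..<card I} = I" by (simp add: bij_betw_def)
  then have "(\<Union>i<card I. U (e i)) = (\<Union>i\<in>I. U i)" by (metis image_image)
  moreover have "P (U (e i))" if "i < card I" for i
    using e that by (intro assms(3)) blast
  ultimately show ?thesis using assms(2) by (intro exI[of _ "\<lambda>i. U (e i)"]) simp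
qed

lemma cover_num_le_card:
  assumes "finite I" "F \<subseteq> (\<Union>i\<in>I. U i)" "\<And>i. i \<in> I \<Longrightarrow> bounded (U i) \<and> diameter (U i) \<le> \<delta>"
  shows "cover_num F \<delta> \<le> card I"
  unfolding cover_num_def
  by (rule Least_le) (rule finite_cover_reindex[OF assms(1,2), of "\<lambda>V. bounded V \<and> diameter V \<le> \<delta>", OF assms(3)])

text \<open>\<open>LEAST\<close> is meaningful only once some finite cover exists, so one such cover
  is part of the hypotheses.\<close>

lemma cover_num_attained:
  assumes "finite I" "F \<subseteq> (\<Union>i\<in>I. U i)" "\<And>i. i \<in> I \<Longrightarrow> bounded (U i) \<and> diameter (U i) \<le> \<delta>"
  obtains W where "F \<subseteq> (\<Union>i<cover_num F \<delta>. W i)"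
    "\<And>i. i < cover_num F \<delta> \<Longrightarrow> bounded (W i) \<and> diameter (W i) \<le> \<delta>"
proof -
  have "\<exists>W::nat \<Rightarrow> _. F \<subseteq> (\<Union>i<cover_num F \<delta>. W i)
      \<and> (\<forall>i<cover_num F \<delta>. bounded (W i) \<and> diameter (W i) \<le> \<delta>)"
    unfolding cover_num_def
    by (rule LeastI)
      (rule finite_cover_reindex[OF assms(1,2), of "\<lambda>V. bounded V \<and> diameter V \<le> \<delta>", OF assms(3)])
  then show ?thesis using that by auto
qed

text \<open>Finite subadditivity of Lebesgue measure. The sets \<open>W i\<close> may fail to be
  measurable, so each is first enlarged to a closed interval of length \<open>\<delta>\<close>
  starting at its infimum.\<close>

lemma interval_length_le_cover:
  fixes W :: "'i \<Rightarrow> real set"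
  assumes fin: "finite I" and cov: "{c..d} \<subseteq> (\<Union>i\<in>I. W i)"
    and W: "\<And>i x y. \<lbrakk>i \<in> I; x \<in> W i; y \<in> W i\<rbrakk> \<Longrightarrow> \<bar>x - y\<bar> \<le> \<delta>"
    and "0 \<le> \<delta>"
  shows "d - c \<le> real (card I) * \<delta>"
proof -
  define J where "J i = (if W i = {} then {} else {Inf (W i)..Inf (W i) + \<delta>})" for i
  have WJ: "W i \<subseteq> J i" if "i \<in> I" for i
  proof
    fix x assume x: "x \<in> W i"
    have lb: "x - \<delta> \<le> y" if "y \<in> W i" for y
      using W[OF \<open>i \<in> I\<close> x that] by linarith
    then have "bdd_below (W i)" by (rule bdd_belowI)
    then have 1: "Inf (W i) \<le> x" using x by (rule cInf_lower[rotated])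
    have 2: "x - \<delta> \<le> Inf (W i)"
      using x lb by (intro cInf_greatest) auto
    show "x \<in> J i" using 1 2 x by (auto simp: J_def)
  qed
  have Jm: "J i \<in> sets lborel" "J i \<in> lmeasurable" "measure lborel (J i) \<le> \<delta>" for i
    using \<open>0 \<le> \<delta>\<close> by (auto simp: J_def)
  have "{c..d} \<subseteq> (\<Union>i\<in>I. J i)" using cov WJ by blast
  then have "measure lebesgue {c..d} \<le> measure lebesgue (\<Union>i\<in>I. J i)"
    by (intro measure_mono_fmeasurable) (auto intro!: fmeasurable.finite_UN fin Jm)
  also have "\<dots> \<le> (\<Sum>i\<in>I. measure lebesgue (J i))"
    by (intro measure_UNION_le fin fmeasurableD Jm)
  also have "\<dots> \<le> (\<Sum>i\<in>I. \<delta>)"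
    using Jm by (intro sum_mono) (simp add: measure_completion)
  finally have "measure lebesgue {c..d} \<le> real (card I) * \<delta>" by simp
  moreover have "0 \<le> real (card I) * \<delta>" using \<open>0 \<le> \<delta>\<close> by simp
  ultimately show ?thesis by (cases "c \<le> d") auto
qed

section \<open>Cells and the oscillation of a continuous function on them\<close>

definition cell :: "nat \<Rightarrow> nat \<Rightarrow> real set" where
  "cell n k = {real k / real n..real (Suc k) / real n}"

definition osc_sum :: "(real \<Rightarrow> real) \<Rightarrow> nat \<Rightarrow> real" where
  "osc_sum h n = (\<Sum>k<n. diameter (h ` cell n k))"

lemma cell_subset: "k < n \<Longrightarrow> cell n k \<subseteq> {0..1}"
  by (auto simp: cell_def divide_simps)

lemma in_cell_ex:
  assumes "x \<in> {0..1}" "0 < n"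
  shows "\<exists>k<n. x \<in> cell n k"
\<comment> \<open>At x = 1 the floor would return the index n, one too many; the last closed cell
  contains this point.\<close>
proof (cases "x = 1")
  case True
  then show ?thesis using assms by (intro exI[of _ "n - 1"]) (auto simp: cell_def divide_simps)
next
  case False
  define k where "k = nat \<lfloor>x * n\<rfloor>"
  have "0 \<le> x * n" "x * n < n" using assms False by auto
  then have "k < n" "real k \<le> x * n" "x * n \<le> real (Suc k)"
    unfolding k_def by linarith+
  then show ?thesis using assms by (intro exI[of _ k]) (auto simp: cell_def field_simps)
qed

lemma image_cell_interval:
  assumes "continuous_on {0..1} h" "k < n"
  obtains c d where "h ` cell n k = {c..d}" "c \<le> d" "diameter (h ` cell n k) = d - c"
proof -
  have ne: "real k / real n \<le> real (Suc k) / real n" by (simp add: divide_right_mono)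
  have "continuous_on (cell n k) h" using assms cell_subset continuous_on_subset by blast
  then obtain c d where "h ` cell n k = {c..d}" "c \<le> d"
    using continuous_image_closed_interval[OF ne] unfolding cell_def by blast
  then show ?thesis using that by simp
qed

lemma abs_diff_le_diameter_cell:
  assumes "continuous_on {0..1} h" "k < n" "x \<in> cell n k" "y \<in> cell n k"
  shows "\<bar>h x - h y\<bar> \<le> diameter (h ` cell n k)"
proof -
  obtain c d where cd: "h ` cell n k = {c..d}" using image_cell_interval[OF assms(1,2)] .
  have "dist (h x) (h y) \<le> diameter (h ` cell n k)"
    using assms(3,4) cd by (intro diameter_bounded_bound) (simp, blast+)
  then show ?thesis by (simp add: dist_real_def)
qed

lemma diameter_cell_le:
  assumes "\<And>x y. \<lbrakk>x \<in> cell n k; y \<in> cell n k\<rbrakk> \<Longrightarrow> \<bar>h x - h y\<bar> \<le> D"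
  shows "diameter (h ` cell n k) \<le> D"
proof (rule diameter_le)
  have "real k / real n \<in> cell n k" by (simp add: cell_def divide_right_mono)
  then show "h ` cell n k \<noteq> {} \<or> 0 \<le> D" by blast
  show "norm (x - y) \<le> D" if "x \<in> h ` cell n k" "y \<in> h ` cell n k" for x y
    using that assms by auto
qed

lemma diameter_cell_nonneg:
  fixes h :: "real \<Rightarrow> real"
  assumes "continuous_on {0..1} h" "k < n"
  shows "0 \<le> diameter (h ` cell n k)"
proof -
  obtain c d where "c \<le> d" "diameter (h ` cell n k) = d - c" using image_cell_interval[OF assms] .
  then show ?thesis by simp
qed

lemma osc_sum_nonneg: "continuous_on {0..1} h \<Longrightarrow> 0 \<le> osc_sum h n"
  by (auto simp: osc_sum_def intro!: sum_nonneg diameter_cell_nonneg)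

section \<open>Covers of a graph compared with its oscillation sum\<close>

lemma graph_cover:
  assumes h: "continuous_on {0..1} h" and n: "0 < n"
  obtains I :: "(nat \<times> nat) set" and U where "finite I" "graph01 h \<subseteq> (\<Union>i\<in>I. U i)"
    "\<And>i. i \<in> I \<Longrightarrow> bounded (U i) \<and> diameter (U i) \<le> 2 / real n"
    "real (card I) \<le> real n * osc_sum h n + real n"
proof -
  define o' where "o' k = diameter (h ` cell n k)" for k
  \<comment> \<open>Number of squares of side 1/n stacked over cell k, starting at the minimum
    \<open>c k\<close>. The extra square keeps the index j in range even where h attains its maximum
    on the cell.\<close>
  define m where "m k = nat \<lfloor>o' k * n\<rfloor> + 1" for k
  define c where "c k = Inf (h ` cell n k)" for k
  define U where "U = (\<lambda>(k, j). cell n k \<times> {c k + real j / n..c k + real (Suc j) / n})"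
  define I where "I = Sigma {..<n} (\<lambda>k. {..<m k})"
  have fin: "finite I" by (simp add: I_def)
  have diam: "bounded (U i) \<and> diameter (U i) \<le> 2 / real n" for i
  proof -
    obtain k j where i: "i = (k, j)" by force
    have "bounded (U i)" by (simp add: i U_def cell_def bounded_Times)
    moreover have "diameter (U i) \<le> 2 / real n"
    proof (rule diameter_le)
      show "U i \<noteq> {} \<or> 0 \<le> 2 / real n" by simp
      fix p q assume "p \<in> U i" "q \<in> U i"
      then have "\<bar>fst p - fst q\<bar> \<le> 1 / n" "\<bar>snd p - snd q\<bar> \<le> 1 / n"
        by (auto simp: i U_def cell_def add_divide_distrib)
      \<comment> \<open>Bounding the Euclidean norm by the sum of the coordinates gives 2/n, which
        suffices in place of the exact diagonal.\<close>
      moreover have "norm (p - q) \<le> norm (fst (p - q)) + norm (snd (p - q))"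
        by (metis norm_Pair_le prod.collapse)
      ultimately show "norm (p - q) \<le> 2 / real n" by auto
    qed
    ultimately show ?thesis ..
  qed
  have cov: "graph01 h \<subseteq> (\<Union>i\<in>I. U i)"
  proof
    fix p assume "p \<in> graph01 h"
    then obtain x where x: "x \<in> {0..1}" "p = (x, h x)" by (auto simp: graph01_def)
    obtain k where k: "k < n" "x \<in> cell n k" using in_cell_ex[OF x(1) n] by blast
    obtain a b where ab: "h ` cell n k = {a..b}" "a \<le> b" "o' k = b - a"
      using image_cell_interval[OF h k(1)] unfolding o'_def .
    have ca: "c k = a" using ab by (simp add: c_def)
    have hx: "a \<le> h x" "h x \<le> b" using ab(1) k(2) by auto
    define j where "j = nat \<lfloor>(h x - a) * n\<rfloor>"
    have nn: "0 \<le> (h x - a) * n" using hx by simp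
    have le: "(h x - a) * n \<le> o' k * n" using hx ab by (intro mult_right_mono) auto
    have "j < m k" unfolding j_def m_def using le by (simp add: floor_mono nat_mono le_imp_less_Suc)
    moreover have "real j \<le> (h x - a) * n" "(h x - a) * n \<le> real (Suc j)"
      using nn unfolding j_def by linarith+
    then have "real j / n \<le> h x - a" "h x - a \<le> real (Suc j) / n"
      using n by (auto simp: field_simps)
    ultimately show "p \<in> (\<Union>i\<in>I. U i)"
      using k x ca by (intro UN_I[of "(k, j)"]) (auto simp: I_def U_def)
  qed
  have "real (card I) = (\<Sum>k<n. real (m k))" by (simp add: I_def)
  also have "\<dots> \<le> (\<Sum>k<n. o' k * n + 1)"
  proof (intro sum_mono)
    fix k assume "k \<in> {..<n}"
    then have "0 \<le> o' k * n" using diameter_cell_nonneg[OF h] by (simp add: o'_def)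
    then show "real (m k) \<le> o' k * n + 1" unfolding m_def by linarith
  qed
  also have "\<dots> = real n * osc_sum h n + real n"
    by (simp add: sum.distrib osc_sum_def o'_def sum_distrib_left mult.commute)
  finally show ?thesis using that fin cov diam by blast
qed

lemma cover_num_graph_le:
  assumes "continuous_on {0..1} h" "0 < n" "2 / real n \<le> \<delta>"
  shows "real (cover_num (graph01 h) \<delta>) \<le> real n * osc_sum h n + real n"
proof -
  obtain I :: "(nat \<times> nat) set" and U where "finite I" "graph01 h \<subseteq> (\<Union>i\<in>I. U i)"
    "\<And>i. i \<in> I \<Longrightarrow> bounded (U i) \<and> diameter (U i) \<le> 2 / real n"
    and I: "real (card I) \<le> real n * osc_sum h n + real n"
    using graph_cover[OF assms(1,2)] by metis
  then have "cover_num (graph01 h) \<delta> \<le> card I"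
    using assms(3) by (intro cover_num_le_card) (auto intro: order_trans)
  then show ?thesis using I by linarith
qed

text \<open>The squares of \<open>graph_cover\<close> with n at least 2/\<delta> are one admissible
  cover, so a minimal one exists. Boundedness of its members turns the diameter condition into a
  bound on distances.\<close>

lemma graph_optimal_cover:
  assumes "continuous_on {0..1} h" "0 < \<delta>"
  obtains W where "graph01 h \<subseteq> (\<Union>i<cover_num (graph01 h) \<delta>. W i)"
    "\<And>i p q. \<lbrakk>i < cover_num (graph01 h) \<delta>; p \<in> W i; q \<in> W i\<rbrakk> \<Longrightarrow> dist p q \<le> \<delta>"
proof -
  define n where "n = nat \<lceil>2 / \<delta>\<rceil>"
  have "0 < 2 / \<delta>" using assms by simp
  then have n: "0 < n" "2 / \<delta> \<le> n" unfolding n_def by linarith+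
  then have nd: "2 / n \<le> \<delta>" using assms by (simp add: field_simps)
  obtain I :: "(nat \<times> nat) set" and U where I: "finite I" "graph01 h \<subseteq> (\<Union>i\<in>I. U i)"
    "\<And>i. i \<in> I \<Longrightarrow> bounded (U i) \<and> diameter (U i) \<le> 2 / real n"
    using graph_cover[OF assms(1) n(1)] by metis
  have "bounded (U i) \<and> diameter (U i) \<le> \<delta>" if "i \<in> I" for i
    using I(3)[OF that] nd by simp
  from cover_num_attained[OF I(1,2) this] obtain W
    where W: "graph01 h \<subseteq> (\<Union>i<cover_num (graph01 h) \<delta>. W i)"
      "\<And>i. i < cover_num (graph01 h) \<delta> \<Longrightarrow> bounded (W i) \<and> diameter (W i) \<le> \<delta>" by blast
  show ?thesis
    using that[OF W(1)] W(2) by (meson diameter_bounded_bound order_trans)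
qed

text \<open>The first projections of a cover of the graph cover [0,1] and have diameter at most
  \<delta>. In particular the covering number is positive, so its logarithm is meaningful.\<close>

lemma cover_num_graph_ge:
  assumes "continuous_on {0..1} h" "0 < \<delta>"
  shows "1 \<le> real (cover_num (graph01 h) \<delta>) * \<delta>"
proof -
  let ?N = "cover_num (graph01 h) \<delta>"
  obtain W where W: "graph01 h \<subseteq> (\<Union>i<?N. W i)"
    "\<And>i p q. \<lbrakk>i < ?N; p \<in> W i; q \<in> W i\<rbrakk> \<Longrightarrow> dist p q \<le> \<delta>"
    using graph_optimal_cover[OF assms] by metis
  have "1 - 0 \<le> real (card {..<?N}) * \<delta>"
  proof (rule interval_length_le_cover[where W = "\<lambda>i. fst ` W i"])
    show "{0..1} \<subseteq> (\<Union>i\<in>{..<?N}. fst ` W i)"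
      using W(1) by (force simp: graph01_def)
    show "\<bar>x - y\<bar> \<le> \<delta>" if "i \<in> {..<?N}" "x \<in> fst ` W i" "y \<in> fst ` W i" for i x y
    proof -
      obtain p q where "p \<in> W i" "q \<in> W i" "x = fst p" "y = fst q" using \<open>x \<in> _\<close> \<open>y \<in> _\<close> by blast
      then show ?thesis
        using W(2)[of i p q] that(1) dist_fst_le[of p q] by (simp add: dist_real_def)
    qed
  qed (use assms in auto)
  then show ?thesis by simp
qed

text \<open>Double counting of the pairs (i, k) for which \<open>W i\<close> meets the graph over
  cell k: every column needs many sets, while every set is narrow and meets few columns.\<close>

lemma osc_sum_le_cover_num:
  assumes h: "continuous_on {0..1} h" and n: "0 < n"
  shows "osc_sum h n \<le> 3 * real (cover_num (graph01 h) (1 / real n)) / real n"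
proof -
  define N where "N = cover_num (graph01 h) (1 / real n)"
  have n': "0 < 1 / real n" using n by simp
  obtain W where W: "graph01 h \<subseteq> (\<Union>i<N. W i)"
    "\<And>i p q. \<lbrakk>i < N; p \<in> W i; q \<in> W i\<rbrakk> \<Longrightarrow> dist p q \<le> 1 / real n"
    using graph_optimal_cover[OF h n'] unfolding N_def by metis
  define G where "G k = (\<lambda>x. (x, h x)) ` cell n k" for k
  define R where "R i k \<longleftrightarrow> W i \<inter> G k \<noteq> {}" for i k
  \<comment> \<open>The second projections of the sets meeting column k cover the interval h(cell
    k), and each has diameter at most 1/n.\<close>
  have column: "diameter (h ` cell n k) \<le> real (card {i\<in>{..<N}. R i k}) * (1 / n)" if k: "k < n" for k
  proof -
    obtain c d where cd: "h ` cell n k = {c..d}" "diameter (h ` cell n k) = d - c"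
      using image_cell_interval[OF h k] .
    have "d - c \<le> real (card {i\<in>{..<N}. R i k}) * (1 / n)"
    proof (rule interval_length_le_cover[where W = "\<lambda>i. snd ` (W i \<inter> G k)"])
      show "{c..d} \<subseteq> (\<Union>i\<in>{i\<in>{..<N}. R i k}. snd ` (W i \<inter> G k))"
      proof
        fix y assume "y \<in> {c..d}"
        then obtain x where x: "x \<in> cell n k" "y = h x" using cd(1) by blast
        then have "(x, h x) \<in> graph01 h" using cell_subset[OF k] by (auto simp: graph01_def)
        then obtain i where "i < N" "(x, h x) \<in> W i" using W(1) by blast
        moreover have "(x, h x) \<in> G k" using x by (simp add: G_def)
        ultimately show "y \<in> (\<Union>i\<in>{i\<in>{..<N}. R i k}. snd ` (W i \<inter> G k))"
          unfolding R_def x(2) by force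
      qed
      show "\<bar>x - y\<bar> \<le> 1 / n" if i: "i \<in> {i\<in>{..<N}. R i k}" and x: "x \<in> snd ` (W i \<inter> G k)" and y: "y \<in> snd ` (W i \<inter> G k)" for i x y
      proof -
        obtain p q where "p \<in> W i" "q \<in> W i" "x = snd p" "y = snd q" using x y by blast
        then show ?thesis
          using W(2)[of i p q] i dist_snd_le[of p q] by (simp add: dist_real_def)
      qed
    qed auto
    then show ?thesis using cd(2) by simp
  qed
  \<comment> \<open>If m is the leftmost column met by \<open>W i\<close>, a point of
    \<open>W i\<close> over column k lies at most 1/n to the right of a point over column m. Hence
    k/n \<le> (m+1)/n + 1/n, leaving only m, m+1 and m+2.\<close>
  have row: "card {k\<in>{..<n}. R i k} \<le> 3" if i: "i < N" for i
  proof (cases "\<exists>k. k < n \<and> R i k")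
    case True
    define m where "m = (LEAST k. k < n \<and> R i k)"
    have m: "m < n" "R i m" using LeastI_ex[OF True] unfolding m_def by auto
    have "k \<in> {m..m + 2}" if k: "k < n" "R i k" for k
    proof -
      have "m \<le> k" using k unfolding m_def by (intro Least_le) auto
      moreover have "k \<le> m + 2"
      proof -
        obtain x y where xy: "x \<in> cell n m" "(x, h x) \<in> W i" "y \<in> cell n k" "(y, h y) \<in> W i"
          using m(2) k(2) unfolding R_def G_def by blast
        have "\<bar>x - y\<bar> \<le> 1 / n"
          using W(2)[OF i xy(2,4)] dist_fst_le[of "(x, h x)" "(y, h y)"] by (simp add: dist_real_def)
        moreover have "real k / n \<le> y" "x \<le> (real m + 1) / n" using xy by (auto simp: cell_def add.commute)
        ultimately have "real k / n \<le> (real m + 1) / n + 1 / n" by linarith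
        then have "real k \<le> real m + 2" using n by (simp add: field_simps)
        then show ?thesis by linarith
      qed
      ultimately show ?thesis by simp
    qed
    then have "{k\<in>{..<n}. R i k} \<subseteq> {m..m + 2}" by auto
    then have "card {k\<in>{..<n}. R i k} \<le> card {m..m + 2}" by (intro card_mono) auto
    then show ?thesis by simp
  next
    case False
    then have "{k\<in>{..<n}. R i k} = {}" by auto
    then show ?thesis by (simp only: card.empty)
  qed
  have "osc_sum h n \<le> (\<Sum>k<n. real (card {i\<in>{..<N}. R i k}) * (1 / n))"
    unfolding osc_sum_def using column by (intro sum_mono) auto
  also have "\<dots> = real (\<Sum>k<n. card {i\<in>{..<N}. R i k}) / n"
    by (simp add: sum_divide_distrib)
  also have "(\<Sum>k<n. card {i\<in>{..<N}. R i k}) = (\<Sum>i<N. card {k\<in>{..<n}. R i k})"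
  proof -
    have c: "card {x\<in>A. P x} = (\<Sum>x\<in>A. if P x then 1 else 0)" if "finite A" for A :: "nat set" and P
      using that by (simp add: sum.If_cases Int_def)
    show ?thesis by (simp only: c[OF finite_lessThan]) (rule sum.swap)
  qed
  also have "\<dots> \<le> N * 3" using sum_bounded_above[of "{..<N}" "\<lambda>i. card {k\<in>{..<n}. R i k}" 3] row by simp
  finally show ?thesis using n by (simp add: N_def divide_right_mono mult.commute)
qed

section \<open>Box dimension of a graph and the growth of its oscillation sums\<close>

lemma upper_box_dim_graph_ge_1:
  assumes "continuous_on {0..1} h"
  shows "1 \<le> upper_box_dim (graph01 h)"
proof -
  have "eventually (\<lambda>\<delta>. 1 \<le> ereal (ln (real (cover_num (graph01 h) \<delta>)) / - ln \<delta>)) (at_right 0)"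
    using eventually_at_right_less[of "0::real"] eventually_at_right_real[of 0 1, OF zero_less_one]
  proof eventually_elim
    case (elim \<delta>)
    let ?N = "real (cover_num (graph01 h) \<delta>)"
    have "1 / \<delta> \<le> ?N" using cover_num_graph_ge[OF assms, of \<delta>] elim by (simp add: field_simps)
    then have "ln (1 / \<delta>) \<le> ln ?N" using elim by (intro ln_mono) auto
    moreover have "ln (1 / \<delta>) = - ln \<delta>" "0 < - ln \<delta>" using elim by (auto simp: ln_div)
    ultimately have "1 \<le> ln ?N / - ln \<delta>" by (simp only: pos_le_divide_eq mult_1)
    then show ?case by simp
  qed
  then show ?thesis unfolding upper_box_dim_def by (intro le_Limsup) auto
qed

text \<open>For n = \<lceil>2/\<delta>\<rceil> the covering number is at most n
  \<open>osc_sum h n\<close> + n. The hypothesis \<gamma> \<ge> 1 lets n powr \<gamma> absorb the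
  last summand, and a constant factor disappears after division by - ln \<delta>.\<close>

lemma upper_box_dim_le_of_osc_sum:
  assumes h: "continuous_on {0..1} h" and "1 \<le> \<gamma>"
    and O: "osc_sum h \<in> O(\<lambda>n. real n powr (\<gamma> - 1))"
  shows "upper_box_dim (graph01 h) \<le> ereal \<gamma>"
proof -
  obtain C where C: "0 < C" "eventually (\<lambda>n. norm (osc_sum h n) \<le> C * norm (real n powr (\<gamma> - 1))) at_top"
    using landau_o.bigE[OF O] by blast
  define n where "n \<delta> = nat \<lceil>2 / \<delta>\<rceil>" for \<delta> :: real
  \<comment> \<open>The factor C + 1 comes from absorbing the summand n, the base 3 from n \<le>
    3/\<delta>, valid for \<delta> < 1.\<close>
  define K where "K = (C + 1) * 3 powr \<gamma>"
  have "K > 0" using C by (simp add: K_def)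
  have lim_n: "filterlim n at_top (at_right 0)" unfolding n_def by real_asymp
  have "eventually (\<lambda>\<delta>. ereal (ln (real (cover_num (graph01 h) \<delta>)) / - ln \<delta>)
      \<le> ereal (ln K / - ln \<delta> + \<gamma>)) (at_right 0)"
    using eventually_compose_filterlim[OF C(2) lim_n] eventually_at_right_less[of "0::real"]
      eventually_at_right_real[of 0 1, OF zero_less_one]
  proof eventually_elim
    case (elim \<delta>)
    let ?N = "real (cover_num (graph01 h) \<delta>)"
    have \<delta>: "0 < \<delta>" "\<delta> < 1" using elim by auto
    then have "0 < 2 / \<delta>" "1 \<le> 1 / \<delta>" by auto
    then have n: "0 < n \<delta>" "2 / \<delta> \<le> n \<delta>" "n \<delta> \<le> 3 / \<delta>"
      unfolding n_def by linarith+
    have nd: "2 / n \<delta> \<le> \<delta>" using n \<delta> by (simp add: field_simps)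
    have "osc_sum h (n \<delta>) \<le> C * real (n \<delta>) powr (\<gamma> - 1)"
      using elim(1) osc_sum_nonneg[OF h] by simp
    then have "real (n \<delta>) * osc_sum h (n \<delta>) \<le> n \<delta> * (C * real (n \<delta>) powr (\<gamma> - 1))"
      by (intro mult_left_mono) auto
    also have "\<dots> = C * real (n \<delta>) powr \<gamma>"
      using n by (simp add: powr_diff)
    finally have "?N \<le> C * real (n \<delta>) powr \<gamma> + n \<delta>"
      using cover_num_graph_le[OF h n(1) nd] by linarith
    moreover have "real (n \<delta>) \<le> real (n \<delta>) powr \<gamma>"
      using powr_mono[OF \<open>1 \<le> \<gamma>\<close>, of "real (n \<delta>)"] n by simp
    ultimately have "?N \<le> (C + 1) * real (n \<delta>) powr \<gamma>"
      by (simp add: algebra_simps)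
    also have "\<dots> \<le> (C + 1) * (3 / \<delta>) powr \<gamma>"
      using n C \<open>1 \<le> \<gamma>\<close> by (intro mult_left_mono powr_mono2) auto
    also have "\<dots> = K * \<delta> powr (-\<gamma>)"
      using \<delta> by (simp add: K_def powr_divide powr_minus field_simps)
    finally have le: "?N \<le> K * \<delta> powr (-\<gamma>)" by simp
    have "0 < ?N" using cover_num_graph_ge[OF h \<delta>(1)] by (cases "?N = 0") auto
    then have "ln ?N \<le> ln (K * \<delta> powr (-\<gamma>))" using le \<open>K > 0\<close> \<delta> by simp
    also have "\<dots> = ln K + \<gamma> * - ln \<delta>"
      using \<open>K > 0\<close> \<delta> by (simp add: ln_mult ln_powr)
    finally have "ln ?N / - ln \<delta> \<le> (ln K + \<gamma> * - ln \<delta>) / - ln \<delta>"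
      using \<delta> by (intro divide_right_mono) auto
    also have "\<dots> = ln K / - ln \<delta> + \<gamma>"
      using \<delta> by (simp add: field_simps)
    finally show ?case by simp
  qed
  then have "upper_box_dim (graph01 h) \<le> Limsup (at_right 0) (\<lambda>\<delta>. ereal (ln K / - ln \<delta> + \<gamma>))"
    unfolding upper_box_dim_def by (rule Limsup_mono)
  also have "\<dots> = ereal \<gamma>"
  proof (rule lim_imp_Limsup)
    have "((\<lambda>\<delta>. ln K / - ln \<delta> + \<gamma>) \<longlongrightarrow> \<gamma>) (at_right 0)" by real_asymp
    then show "((\<lambda>\<delta>. ereal (ln K / - ln \<delta> + \<gamma>)) \<longlongrightarrow> ereal \<gamma>) (at_right 0)" by simp
  qed simp
  finally show ?thesis .
qed

text \<open>Strict inequality turns the limsup into an eventual bound on the covering number, which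
  is sampled at \<delta> = 1/n and inserted into \<open>osc_sum_le_cover_num\<close>.\<close>

lemma osc_sum_of_upper_box_dim_less:
  assumes h: "continuous_on {0..1} h" and less: "upper_box_dim (graph01 h) < ereal \<gamma>"
  shows "osc_sum h \<in> O(\<lambda>n. real n powr (\<gamma> - 1))"
proof -
  have ev: "eventually (\<lambda>\<delta>. ereal (ln (real (cover_num (graph01 h) \<delta>)) / - ln \<delta>) < ereal \<gamma>) (at_right 0)"
    using less unfolding upper_box_dim_def by (rule Limsup_lessD)
  have lim: "filterlim (\<lambda>n. 1 / real n) (at_right 0) sequentially" by real_asymp
  show ?thesis
  proof (rule bigoI[of _ 3])
    show "eventually (\<lambda>n. norm (osc_sum h n) \<le> 3 * norm (real n powr (\<gamma> - 1))) sequentially"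
      using eventually_compose_filterlim[OF ev lim] eventually_gt_at_top[of 1]
    proof eventually_elim
      case (elim n)
      let ?N = "real (cover_num (graph01 h) (1 / real n))"
      have ln: "- ln (1 / real n) = ln (real n)" "0 < ln (real n)" using elim by (auto simp: ln_div)
      have "1 \<le> ?N * (1 / n)" using elim by (intro cover_num_graph_ge h) auto
      then have "0 < ?N" by (cases "?N = 0") auto
      moreover have "ln ?N \<le> \<gamma> * ln (real n)" using elim ln by (simp add: divide_less_eq)
      ultimately have "?N \<le> real n powr \<gamma>"
        using elim exp_le_cancel_iff[of "ln ?N" "\<gamma> * ln (real n)"] by (simp add: powr_def)
      then have "3 * ?N / n \<le> 3 * real n powr \<gamma> / n" by (simp add: divide_right_mono)
      then show ?case
        using osc_sum_le_cover_num[OF h, of n] osc_sum_nonneg[OF h, of n] elim by (simp add: powr_diff)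
    qed
  qed
qed

section \<open>Comparison of dimensions through increments\<close>

lemma upper_box_dim_le_max:
  assumes g: "continuous_on {0..1} g" and h: "continuous_on {0..1} h" and F: "continuous_on {0..1} F"
    and M: "\<And>x y. \<lbrakk>x \<in> {0..1}; y \<in> {0..1}\<rbrakk> \<Longrightarrow> \<bar>F x - F y\<bar> \<le> M * (\<bar>g x - g y\<bar> + \<bar>h x - h y\<bar>)"
    and "0 \<le> M"
  shows "upper_box_dim (graph01 F) \<le> max (upper_box_dim (graph01 g)) (upper_box_dim (graph01 h))"
    (is "_ \<le> ?m")
proof (rule ereal_le_real)
  fix \<gamma>' assume "?m \<le> ereal \<gamma>'"
  show "upper_box_dim (graph01 F) \<le> ereal \<gamma>'"
  \<comment> \<open>Growth bounds for g and h are available only for exponents strictly above their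
    dimensions, so the maximum is approached from above.\<close>
  proof (rule dense_ge)
    fix z assume z: "ereal \<gamma>' < z"
    show "upper_box_dim (graph01 F) \<le> z"
    proof (cases z)
      case (real \<gamma>)
      have less: "upper_box_dim (graph01 g) < ereal \<gamma>" "upper_box_dim (graph01 h) < ereal \<gamma>"
        using le_less_trans[OF \<open>?m \<le> ereal \<gamma>'\<close> z] unfolding real max_less_iff_conj by blast+
      \<comment> \<open>The exponent must be at least 1 for
        \<open>upper_box_dim_le_of_osc_sum\<close>; this holds because every graph has dimension at
        least 1.\<close>
      have "ereal 1 < ereal \<gamma>"
        using le_less_trans[OF upper_box_dim_graph_ge_1[OF g] less(1)] by (simp add: one_ereal_def)
      \<comment> \<open>The domination of increments passes to the oscillation on each cell, and
        then to the sums.\<close>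
      have le: "osc_sum F n \<le> M * (osc_sum g n + osc_sum h n)" for n
      proof -
        have "osc_sum F n \<le> (\<Sum>k<n. M * (diameter (g ` cell n k) + diameter (h ` cell n k)))"
          unfolding osc_sum_def
        proof (intro sum_mono diameter_cell_le)
          fix k x y assume k: "k \<in> {..<n}" and xy: "x \<in> cell n k" "y \<in> cell n k"
          have "\<bar>F x - F y\<bar> \<le> M * (\<bar>g x - g y\<bar> + \<bar>h x - h y\<bar>)"
            using cell_subset[of k n] k xy by (intro M) auto
          also have "\<dots> \<le> M * (diameter (g ` cell n k) + diameter (h ` cell n k))"
            using k xy by (intro mult_left_mono add_mono abs_diff_le_diameter_cell g h \<open>0 \<le> M\<close>) auto
          finally show "\<bar>F x - F y\<bar> \<le> \<dots>" .
        qed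
        then show ?thesis
          by (simp only: osc_sum_def flip: sum_distrib_left sum.distrib)
      qed
      have "osc_sum F \<in> O(\<lambda>n. osc_sum g n + osc_sum h n)"
      proof (rule bigoI[of _ M])
        show "eventually (\<lambda>n. norm (osc_sum F n) \<le> M * norm (osc_sum g n + osc_sum h n)) sequentially"
          using le osc_sum_nonneg[OF F] osc_sum_nonneg[OF g] osc_sum_nonneg[OF h] by simp
      qed
      also have "(\<lambda>n. osc_sum g n + osc_sum h n) \<in> O(\<lambda>n. real n powr (\<gamma> - 1))"
        by (intro sum_in_bigo osc_sum_of_upper_box_dim_less g h less)
      finally show ?thesis
        using upper_box_dim_le_of_osc_sum[OF F, of \<gamma>] \<open>ereal 1 < ereal \<gamma>\<close> real by simp
    qed (use z in auto)
  qed
qed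

lemma upper_box_dim_le_of_increments:
  assumes h: "continuous_on {0..1} h" and F: "continuous_on {0..1} F"
    and M: "\<And>x y. \<lbrakk>x \<in> {0..1}; y \<in> {0..1}\<rbrakk> \<Longrightarrow> \<bar>F x - F y\<bar> \<le> M * \<bar>h x - h y\<bar>"
    and "0 \<le> M"
  shows "upper_box_dim (graph01 F) \<le> upper_box_dim (graph01 h)"
proof -
  have "\<bar>F x - F y\<bar> \<le> M * (\<bar>h x - h y\<bar> + \<bar>h x - h y\<bar>)" if "x \<in> {0..1}" "y \<in> {0..1}" for x y
  proof -
    have "0 \<le> M * \<bar>h x - h y\<bar>" using \<open>0 \<le> M\<close> by simp
    then show ?thesis using M[OF that] by (simp add: distrib_left)
  qed
  from upper_box_dim_le_max[OF h h F this \<open>0 \<le> M\<close>] show ?thesis by simp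
qed

section \<open>Products and quotients\<close>

lemma continuous_on_abs_bound:
  fixes h :: "real \<Rightarrow> real"
  assumes "continuous_on {0..1} h"
  obtains B where "0 < B" "\<And>x. x \<in> {0..1} \<Longrightarrow> \<bar>h x\<bar> \<le> B"
proof -
  have "bounded (h ` {0..1})"
    using assms by (intro compact_imp_bounded compact_continuous_image) auto
  then show ?thesis using that unfolding bounded_pos by auto
qed

lemma continuous_on_abs_lower_bound:
  fixes h :: "real \<Rightarrow> real"
  assumes "continuous_on {0..1} h" "\<And>x. x \<in> {0..1} \<Longrightarrow> h x \<noteq> 0"
  obtains m where "0 < m" "\<And>x. x \<in> {0..1} \<Longrightarrow> m \<le> \<bar>h x\<bar>"
proof -
  have "continuous_on {0..1} (\<lambda>x. inverse (h x))"
    using assms by (intro continuous_intros) auto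
  then obtain B where B: "0 < B" "\<And>x. x \<in> {0..1} \<Longrightarrow> \<bar>inverse (h x)\<bar> \<le> B"
    using continuous_on_abs_bound[where h = "\<lambda>x. inverse (h x)"] by metis
  have "1 / B \<le> \<bar>h x\<bar>" if "x \<in> {0..1}" for x
    using B(2)[OF that] B(1) assms(2)[OF that] by (simp add: field_simps)
  then show ?thesis using that[of "1 / B"] B(1) by simp
qed

text \<open>The usual splitting of the increment of a product, with both factors bounded on [0,1],
  puts it in the form required by \<open>upper_box_dim_le_max\<close>.\<close>

lemma upper_box_dim_mult_le:
  assumes g: "continuous_on {0..1} g" and h: "continuous_on {0..1} h" and F: "continuous_on {0..1} F"
    and eq: "\<And>x. x \<in> {0..1} \<Longrightarrow> F x = g x * h x"
  shows "upper_box_dim (graph01 F) \<le> max (upper_box_dim (graph01 g)) (upper_box_dim (graph01 h))"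
proof -
  obtain A where A: "0 < A" "\<And>x. x \<in> {0..1} \<Longrightarrow> \<bar>g x\<bar> \<le> A" using continuous_on_abs_bound[OF g] by metis
  obtain B where B: "0 < B" "\<And>x. x \<in> {0..1} \<Longrightarrow> \<bar>h x\<bar> \<le> B" using continuous_on_abs_bound[OF h] by metis
  show ?thesis
  proof (rule upper_box_dim_le_max[OF g h F])
    fix x y :: real assume xy: "x \<in> {0..1}" "y \<in> {0..1}"
    have "F x - F y = g x * (h x - h y) + h y * (g x - g y)"
      by (simp add: eq[OF xy(1)] eq[OF xy(2)] algebra_simps)
    then have "\<bar>F x - F y\<bar> \<le> \<bar>g x\<bar> * \<bar>h x - h y\<bar> + \<bar>h y\<bar> * \<bar>g x - g y\<bar>"
      using abs_triangle_ineq by (simp add: abs_mult[symmetric])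
    also have "\<dots> \<le> (A + B) * \<bar>h x - h y\<bar> + (A + B) * \<bar>g x - g y\<bar>"
      using A(1) B(1) A(2)[OF xy(1)] B(2)[OF xy(2)] by (intro add_mono mult_right_mono) auto
    finally show "\<bar>F x - F y\<bar> \<le> (A + B) * (\<bar>g x - g y\<bar> + \<bar>h x - h y\<bar>)"
      by (simp add: distrib_left)
  qed (use A B in simp)
qed

text \<open>Where 1/h is bounded by B, its increments are at most B * B times those of h, so
  inversion does not raise the dimension; the product bound does the rest.\<close>

lemma upper_box_dim_divide_le:
  assumes g: "continuous_on {0..1} g" and h: "continuous_on {0..1} h" and F: "continuous_on {0..1} F"
    and nz: "\<And>x. x \<in> {0..1} \<Longrightarrow> h x \<noteq> 0" and eq: "\<And>x. x \<in> {0..1} \<Longrightarrow> F x = g x / h x"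
  shows "upper_box_dim (graph01 F) \<le> max (upper_box_dim (graph01 g)) (upper_box_dim (graph01 h))"
proof -
  let ?i = "\<lambda>x. inverse (h x)"
  have i: "continuous_on {0..1} ?i" using h nz by (intro continuous_intros) auto
  obtain B where B: "0 < B" "\<And>x. x \<in> {0..1} \<Longrightarrow> \<bar>?i x\<bar> \<le> B"
    using continuous_on_abs_bound[OF i] by metis
  have "upper_box_dim (graph01 ?i) \<le> upper_box_dim (graph01 h)"
  proof (rule upper_box_dim_le_of_increments[OF h i])
    fix x y :: real assume xy: "x \<in> {0..1}" "y \<in> {0..1}"
    have "?i x - ?i y = - (?i x * ?i y * (h x - h y))"
      using nz[OF xy(1)] nz[OF xy(2)] by (simp add: field_simps)
    then have "\<bar>?i x - ?i y\<bar> = \<bar>?i x\<bar> * \<bar>?i y\<bar> * \<bar>h x - h y\<bar>"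
      by (simp only: abs_minus_cancel abs_mult)
    also have "\<dots> \<le> B * B * \<bar>h x - h y\<bar>"
      using B(1) B(2)[OF xy(1)] B(2)[OF xy(2)] by (intro mult_right_mono mult_mono) auto
    finally show "\<bar>?i x - ?i y\<bar> \<le> B * B * \<bar>h x - h y\<bar>" .
  qed (use B in simp)
  moreover have "upper_box_dim (graph01 F) \<le> max (upper_box_dim (graph01 g)) (upper_box_dim (graph01 ?i))"
    by (rule upper_box_dim_mult_le[OF g i F]) (simp add: eq divide_inverse)
  ultimately show ?thesis by (meson max.mono order_refl order_trans)
qed

subsection \<open>A Takagi function with graph of prescribed dimension\<close>

text \<open>The distance to the nearest integer, the sawtooth wave from which the Takagi function is
  built.\<close>

definition tri :: "real \<Rightarrow> real" where
  "tri x = \<bar>x - of_int (round x)\<bar>"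

lemma tri_le: "tri x \<le> \<bar>x - of_int z\<bar>"
  unfolding tri_def using round_diff_minimal[of x z] by simp

lemma tri_bounds: "0 \<le> tri x" "tri x \<le> 1 / 2"
  unfolding tri_def using of_int_round_abs_le[of x] by (auto simp: abs_minus_commute)

lemma tri_lipschitz: "\<bar>tri x - tri y\<bar> \<le> \<bar>x - y\<bar>"
proof -
  have "tri x \<le> \<bar>x - y\<bar> + tri y" for x y
    using tri_le[of x "round y"] unfolding tri_def[of y] by linarith
  from this[of x y] this[of y x] show ?thesis by linarith
qed

text \<open>Any integer other than z is at distance at least 1 from z, hence at least 1/2 from x. At
  a half-integer both neighbours give the same distance.\<close>

lemma tri_eq:
  assumes "\<bar>x - of_int z\<bar> \<le> 1 / 2"
  shows "tri x = \<bar>x - of_int z\<bar>"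
proof (rule antisym[OF tri_le])
  show "\<bar>x - of_int z\<bar> \<le> tri x"
  proof (cases "round x = z")
    case False
    then have "1 \<le> \<bar>real_of_int (round x) - of_int z\<bar>" by linarith
    then show ?thesis using assms unfolding tri_def by linarith
  qed (simp add: tri_def)
qed

lemma tri_nat [simp]: "tri (real k) = 0"
  by (simp add: tri_def)

text \<open>The wave is affine on each interval between consecutive half-integers: rising for even
  j, falling for odd j.\<close>

lemma tri_midpoint:
  fixes j :: int
  assumes "of_int j / 2 \<le> x" "x \<le> y" "y \<le> (of_int j + 1) / 2"
  shows "tri ((x + y) / 2) = (tri x + tri y) / 2"
proof (cases "even j")
  case True
  then obtain z where z: "j = 2 * z" by blast
  have "tri t = t - of_int z" if "x \<le> t" "t \<le> y" for t
    using tri_eq[of t z] assms that z by auto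
  from this[of x] this[of y] this[of "(x + y) / 2"] show ?thesis using assms by (auto simp: field_simps)
next
  case False
  then obtain z where z: "j = 2 * z + 1" by (rule oddE)
  have "tri t = of_int (z + 1) - t" if "x \<le> t" "t \<le> y" for t
    using tri_eq[of t "z + 1"] assms that z by auto
  from this[of x] this[of y] this[of "(x + y) / 2"] show ?thesis using assms by (auto simp: field_simps)
qed

text \<open>The factor \<open>1 / (m + 1)\<^sup>2\<close> keeps the series summable when \<open>\<alpha> = 0\<close>, i.e. \<open>\<beta> = 2\<close>; being
subexponential in m, it does not affect the dimension.\<close>
definition takagi_coeff :: "real \<Rightarrow> nat \<Rightarrow> real" where
  "takagi_coeff \<alpha> m = 2 powr (- (\<alpha> * real m)) * (1 / (real m + 1)\<^sup>2)"

text \<open>Up to the subexponential factor the weights decay like 2 powr (- \<alpha> m) at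
  frequency 2^m. For \<alpha> in [0,1] this gives Hoelder exponent \<alpha> and graph dimension 2 -
  \<alpha>.\<close>

definition takagi :: "real \<Rightarrow> real \<Rightarrow> real" where
  "takagi \<alpha> x = (\<Sum>m. takagi_coeff \<alpha> m * tri (2 ^ m * x))"

section \<open>Convergence, continuity and Hoelder regularity of the Takagi function\<close>

lemma summable_inverse_Suc_squares: "summable (\<lambda>m. 1 / (real m + 1)\<^sup>2)"
proof -
  have "summable (\<lambda>n. inverse (real (Suc n) ^ 2))"
    by (subst summable_Suc_iff) (rule inverse_power_summable, simp)
  then show ?thesis by (simp add: field_simps)
qed

lemma takagi_coeff_pos: "0 < takagi_coeff \<alpha> m"
  by (simp add: takagi_coeff_def)

lemma takagi_term_bound:
  assumes "0 \<le> \<alpha>"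
  shows "norm (takagi_coeff \<alpha> m * tri t) \<le> 1 / (real m + 1)\<^sup>2"
proof -
  have "2 powr (- (\<alpha> * real m)) \<le> 2 powr 0" using assms by (intro powr_mono) auto
  then have "takagi_coeff \<alpha> m \<le> 1 * (1 / (real m + 1)\<^sup>2)"
    unfolding takagi_coeff_def by (intro mult_right_mono) auto
  moreover have "takagi_coeff \<alpha> m * tri t \<le> takagi_coeff \<alpha> m * 1"
    using takagi_coeff_pos[of \<alpha> m] tri_bounds[of t] by (intro mult_left_mono) auto
  moreover have "norm (takagi_coeff \<alpha> m * tri t) = takagi_coeff \<alpha> m * tri t"
    using takagi_coeff_pos[of \<alpha> m] tri_bounds[of t] by simp
  ultimately show ?thesis by linarith
qed

lemma summable_takagi:
  assumes "0 \<le> \<alpha>"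
  shows "summable (\<lambda>m. takagi_coeff \<alpha> m * tri (2 ^ m * x))"
  by (rule summable_comparison_test'[OF summable_inverse_Suc_squares]) (rule takagi_term_bound[OF assms])

lemma takagi_nonneg: "0 \<le> \<alpha> \<Longrightarrow> 0 \<le> takagi \<alpha> x"
  unfolding takagi_def
  by (intro suminf_nonneg summable_takagi mult_nonneg_nonneg tri_bounds less_imp_le[OF takagi_coeff_pos])

lemma continuous_on_tri: "continuous_on S tri"
  unfolding continuous_on_iff dist_real_def using tri_lipschitz by (meson le_less_trans)

lemma continuous_on_takagi:
  assumes "0 \<le> \<alpha>"
  shows "continuous_on S (takagi \<alpha>)"
proof -
  have "uniform_limit S (\<lambda>n x. \<Sum>m<n. takagi_coeff \<alpha> m * tri (2 ^ m * x)) (takagi \<alpha>) sequentially"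
    unfolding takagi_def
    by (rule Weierstrass_m_test[OF takagi_term_bound[OF assms] summable_inverse_Suc_squares])
  then show ?thesis
    by (rule uniform_limit_theorem[rotated])
      (auto intro!: always_eventually continuous_intros continuous_on_compose2[OF continuous_on_tri[of UNIV]])
qed

text \<open>The m-th wave changes by at most min 1 (2^m d) \<le> (2^m d) powr \<alpha>. The weight 2
  powr (- \<alpha> m) cancels the frequency, and the summable factor 1/(m+1)^2 remains.\<close>

lemma takagi_hoelder:
  assumes "0 \<le> \<alpha>" "\<alpha> \<le> 1" "\<bar>x - y\<bar> \<le> d" "0 < d"
  shows "\<bar>takagi \<alpha> x - takagi \<alpha> y\<bar> \<le> d powr \<alpha> * (\<Sum>m. 1 / (real m + 1)\<^sup>2)"
proof -
  define D where "D m = takagi_coeff \<alpha> m * tri (2 ^ m * x) - takagi_coeff \<alpha> m * tri (2 ^ m * y)" for m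
  have bound: "norm (D m) \<le> d powr \<alpha> * (1 / (real m + 1)\<^sup>2)" for m
  proof -
    let ?\<Delta> = "\<bar>tri (2 ^ m * x) - tri (2 ^ m * y)\<bar>"
    have p: "2 powr (- (\<alpha> * real m)) = (2 ^ m) powr (- \<alpha>)"
      by (simp add: powr_powr mult.commute flip: powr_realpow)
    have "?\<Delta> \<le> \<bar>2 ^ m * x - 2 ^ m * y\<bar>" by (rule tri_lipschitz)
    also have "\<dots> = 2 ^ m * \<bar>x - y\<bar>" by (simp add: abs_mult flip: right_diff_distrib)
    also have "\<dots> \<le> 2 ^ m * d" using assms by simp
    finally have "?\<Delta> \<le> 2 ^ m * d" .
    moreover have "?\<Delta> \<le> 1" using tri_bounds[of "2 ^ m * x"] tri_bounds[of "2 ^ m * y"] by linarith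
    moreover have "min 1 t \<le> t powr \<alpha>" if "0 < t" for t :: real
    proof (cases "1 \<le> t")
      case True
      then show ?thesis using assms by (simp add: ge_one_powr_ge_zero)
    next
      case False
      then show ?thesis using powr_mono'[OF \<open>\<alpha> \<le> 1\<close>, of t] that by simp
    qed
    ultimately have "?\<Delta> \<le> (2 ^ m * d) powr \<alpha>"
      using \<open>0 < d\<close> by (smt (verit) min_def mult_pos_pos zero_less_power)
    then have "2 powr (- (\<alpha> * real m)) * ?\<Delta> \<le> (2 ^ m) powr (- \<alpha>) * (2 ^ m * d) powr \<alpha>"
      unfolding p by (intro mult_left_mono) auto
    also have "\<dots> = d powr \<alpha>"
      using assms by (simp add: powr_mult powr_minus)
    finally have "2 powr (- (\<alpha> * real m)) * ?\<Delta> * (1 / (real m + 1)\<^sup>2) \<le> d powr \<alpha> * (1 / (real m + 1)\<^sup>2)"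
      by (intro mult_right_mono) auto
    moreover have "norm (D m) = 2 powr (- (\<alpha> * real m)) * ?\<Delta> * (1 / (real m + 1)\<^sup>2)"
      unfolding D_def takagi_coeff_def right_diff_distrib[symmetric] by (simp add: abs_mult)
    ultimately show ?thesis by simp
  qed
  have "takagi \<alpha> x - takagi \<alpha> y = (\<Sum>m. D m)"
    unfolding takagi_def D_def by (intro suminf_diff summable_takagi assms)
  also have "norm \<dots> \<le> (\<Sum>m. d powr \<alpha> * (1 / (real m + 1)\<^sup>2))"
    by (intro norm_suminf_le bound summable_mult summable_inverse_Suc_squares)
  also have "\<dots> = d powr \<alpha> * (\<Sum>m. 1 / (real m + 1)\<^sup>2)"
    by (intro suminf_mult summable_inverse_Suc_squares)
  finally show ?thesis by simp
qed

text \<open>At a dyadic midpoint of level n the terms of higher frequency vanish and those of lower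
frequency are affine, so only the n-th term survives.\<close>
lemma takagi_second_difference:
  fixes n k :: nat
  assumes "0 \<le> \<alpha>"
  defines "x \<equiv> real k / 2 ^ n" and "y \<equiv> real (Suc k) / 2 ^ n"
  shows "takagi \<alpha> ((x + y) / 2) - (takagi \<alpha> x + takagi \<alpha> y) / 2 = takagi_coeff \<alpha> n / 2"
proof -
  define E where "E m = tri (2 ^ m * ((x + y) / 2)) - (tri (2 ^ m * x) + tri (2 ^ m * y)) / 2" for m
  have mid: "2 ^ n * ((x + y) / 2) = real k + 1 / 2" by (simp add: x_def y_def field_simps)
  have En: "E n = 1 / 2"
  proof -
    have "2 ^ n * x = real k" "2 ^ n * y = real (Suc k)" by (auto simp: x_def y_def)
    moreover have "tri (real k + 1 / 2) = 1 / 2" using tri_eq[of "real k + 1 / 2" "int k"] by simp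
    ultimately show ?thesis unfolding E_def mid by (simp only: tri_nat) simp
  qed
  have E0: "E m = 0" if "m \<noteq> n" for m
  proof (cases "n < m")
    case True
    \<comment> \<open>For higher frequencies all three scaled points are integers, where
      \<open>tri\<close> vanishes.\<close>
    then obtain p where p: "m = Suc (n + p)" using less_imp_Suc_add by blast
    have "2 ^ m * x = real (2 ^ Suc p * k)" "2 ^ m * y = real (2 ^ Suc p * Suc k)"
      "2 ^ m * ((x + y) / 2) = real (2 ^ p * (2 * k + 1))"
      by (auto simp: p x_def y_def power_add field_simps)
    then show ?thesis unfolding E_def by (simp only: tri_nat) simp
  next
    case False
    then have "m < n" using that by simp
    then obtain p where p: "n = Suc (m + p)" using less_imp_Suc_add by blast
    \<comment> \<open>Since 2^m x = k / 2^(p+1), the interval from j/2 to (j+1)/2 contains 2^m x. By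
      integrality k + 1 does not exceed (j+1) 2^p, so it contains 2^m y as well and
      \<open>tri_midpoint\<close> applies.\<close>
    define j where "j = int (k div 2 ^ p)"
    have x: "2 ^ m * x = real k / (2 * 2 ^ p)" and y: "2 ^ m * y = (real k + 1) / (2 * 2 ^ p)"
      by (auto simp: p x_def y_def power_add field_simps)
    have "k div 2 ^ p * 2 ^ p \<le> k" by simp
    then have 1: "of_int j * 2 ^ p \<le> real k"
      unfolding j_def of_int_of_nat_eq by (metis of_nat_le_iff of_nat_mult of_nat_numeral of_nat_power)
    have "k < (k div 2 ^ p + 1) * 2 ^ p" using dividend_less_div_times[of "2 ^ p" k] by simp
    then have "k + 1 \<le> (k div 2 ^ p + 1) * 2 ^ p" by simp
    then have "real (k + 1) \<le> real ((k div 2 ^ p + 1) * 2 ^ p)" by (simp only: of_nat_le_iff)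
    then have 2: "real k + 1 \<le> (of_int j + 1) * 2 ^ p" unfolding j_def by (simp add: algebra_simps)
    have "tri ((2 ^ m * x + 2 ^ m * y) / 2) = (tri (2 ^ m * x) + tri (2 ^ m * y)) / 2"
    proof (rule tri_midpoint[of j])
      show "of_int j / 2 \<le> 2 ^ m * x" using 1 unfolding x by (simp add: field_simps)
      show "2 ^ m * x \<le> 2 ^ m * y" unfolding x y by (simp add: field_simps)
      show "2 ^ m * y \<le> (of_int j + 1) / 2" using 2 unfolding y by (simp add: field_simps)
    qed
    moreover have "(2 ^ m * x + 2 ^ m * y) / 2 = 2 ^ m * ((x + y) / 2)" by (simp add: field_simps)
    ultimately show ?thesis unfolding E_def by simp
  qed
  have "(\<lambda>m. takagi_coeff \<alpha> m * E m) sums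
      (takagi \<alpha> ((x + y) / 2) - (takagi \<alpha> x + takagi \<alpha> y) / 2)"
  proof -
    have s: "(\<lambda>m. takagi_coeff \<alpha> m * tri (2 ^ m * t)) sums takagi \<alpha> t" for t
      unfolding takagi_def by (rule summable_sums[OF summable_takagi[OF assms(1)]])
    show ?thesis
      using sums_diff[OF s[of "(x + y) / 2"] sums_divide[OF sums_add[OF s[of x] s[of y]], of 2]]
      unfolding E_def by (simp add: algebra_simps diff_divide_distrib add_divide_distrib)
  qed
  moreover have "(\<lambda>m. takagi_coeff \<alpha> m * E m) sums (\<Sum>m\<in>{n}. takagi_coeff \<alpha> m * E m)"
    by (rule sums_finite) (auto simp: E0)
  ultimately show ?thesis using sums_unique2 En by force
qed

text \<open>The Hoelder bound gives \<open>osc_sum g n\<close> of order at most n powr (\<beta> -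
  1). Conversely the second differences force \<open>osc_sum g (2 ^ n)\<close> to be at least of
  order 2 powr ((\<beta> - 1) n) / (n+1)^2, which outgrows every smaller exponent.\<close>

lemma upper_box_dim_takagi:
  assumes "1 \<le> \<beta>" "\<beta> \<le> 2"
  shows "upper_box_dim (graph01 (\<lambda>x. 1 + takagi (2 - \<beta>) x)) = ereal \<beta>"
proof -
  define \<alpha> where "\<alpha> = 2 - \<beta>"
  have \<alpha>: "0 \<le> \<alpha>" "\<alpha> \<le> 1" using assms by (auto simp: \<alpha>_def)
  define g where "g = (\<lambda>x. 1 + takagi \<alpha> x)"
  define S where "S = (\<Sum>m. 1 / (real m + 1)\<^sup>2)"
  have g: "continuous_on {0..1} g"
    unfolding g_def by (intro continuous_intros continuous_on_takagi \<alpha>)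
  have upper: "upper_box_dim (graph01 g) \<le> ereal \<beta>"
  proof (rule upper_box_dim_le_of_osc_sum[OF g \<open>1 \<le> \<beta>\<close>], rule bigoI[of _ S])
    show "eventually (\<lambda>n. norm (osc_sum g n) \<le> S * norm (real n powr (\<beta> - 1))) sequentially"
      using eventually_gt_at_top[of 0]
    proof eventually_elim
      case (elim n)
      have "osc_sum g n \<le> (\<Sum>k<n. (1 / real n) powr \<alpha> * S)"
        unfolding osc_sum_def
      proof (intro sum_mono diameter_cell_le)
        fix k x y assume "x \<in> cell n k" "y \<in> cell n k"
        then have "\<bar>x - y\<bar> \<le> 1 / real n" by (auto simp: cell_def add_divide_distrib)
        then show "\<bar>g x - g y\<bar> \<le> (1 / real n) powr \<alpha> * S"
          using takagi_hoelder[OF \<alpha>, of x y "1 / real n"] elim by (simp add: g_def S_def)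
      qed
      also have "\<dots> = S * (real n * (1 / real n) powr \<alpha>)"
        by (simp only: sum_constant card_lessThan) (simp only: mult_ac)
      also have "(1 / real n) powr \<alpha> = real n powr (- \<alpha>)"
        unfolding powr_divide powr_minus_divide powr_one_eq_one ..
      also have "real n * real n powr (- \<alpha>) = real n powr (1 + - \<alpha>)"
        by (rule powr_mult_base) simp
      also have "1 + - \<alpha> = \<beta> - 1" by (simp add: \<alpha>_def)
      finally show ?case using osc_sum_nonneg[OF g, of n] by simp
    qed
  qed
  have lower: "ereal \<beta> \<le> upper_box_dim (graph01 g)"
  proof (rule ccontr)
    assume "\<not> ?thesis"
    then have "upper_box_dim (graph01 g) < ereal \<beta>" by (simp only: not_le)
    from ereal_dense2[OF this]
    obtain \<gamma> where \<gamma>: "upper_box_dim (graph01 g) < ereal \<gamma>" "\<gamma> < \<beta>" by auto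
    have osc: "2 ^ n * (takagi_coeff \<alpha> n / 2) \<le> osc_sum g (2 ^ n)" for n
    proof -
      have "takagi_coeff \<alpha> n / 2 \<le> diameter (g ` cell (2 ^ n) k)" if k: "k < 2 ^ n" for k
      proof -
        define x y where "x = real k / 2 ^ n" and "y = real (Suc k) / 2 ^ n"
        have "x \<le> y" by (simp add: x_def y_def divide_right_mono)
        moreover have cell: "cell (2 ^ n) k = {x..y}" by (simp add: cell_def x_def y_def)
        ultimately have mem: "x \<in> cell (2 ^ n) k" "y \<in> cell (2 ^ n) k" "(x + y) / 2 \<in> cell (2 ^ n) k"
          by (auto simp: cell)
        \<comment> \<open>The second difference is the average of the two increments from the
          endpoints to the midpoint, and each of these is at most the diameter of the image of the
          cell.\<close>
        have "takagi_coeff \<alpha> n / 2 = g ((x + y) / 2) - (g x + g y) / 2"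
          using takagi_second_difference[OF \<alpha>(1), of k n] by (simp add: g_def x_def y_def field_simps)
        then show ?thesis
          using abs_diff_le_diameter_cell[OF g k mem(3,1)] abs_diff_le_diameter_cell[OF g k mem(3,2)]
          by (simp add: field_simps)
      qed
      then have "(\<Sum>k<2 ^ n::nat. takagi_coeff \<alpha> n / 2) \<le> osc_sum g (2 ^ n)"
        unfolding osc_sum_def by (intro sum_mono) auto
      then show ?thesis by simp
    qed
    obtain C where C: "eventually (\<lambda>n. norm (osc_sum g n) \<le> C * norm (real n powr (\<gamma> - 1))) sequentially"
      using osc_sum_of_upper_box_dim_less[OF g \<gamma>(1)] by (rule landau_o.bigE)
    have "filterlim (\<lambda>n. 2 ^ n :: nat) sequentially sequentially" by real_asymp
    from eventually_compose_filterlim[OF C this]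
    have "eventually (\<lambda>n. 2 powr ((\<beta> - \<gamma>) * real n) / (real n + 1)\<^sup>2 \<le> 2 * C) sequentially"
    proof eventually_elim
      case (elim n)
      have "2 ^ n * (takagi_coeff \<alpha> n / 2) \<le> C * (2 ^ n) powr (\<gamma> - 1)"
        using osc[of n] elim by simp
      moreover have "(2 ^ n) powr (\<gamma> - 1) = 2 powr (real n * (\<gamma> - 1))"
        by (simp add: powr_powr flip: powr_realpow)
      moreover have "2 ^ n * takagi_coeff \<alpha> n = 2 powr ((\<beta> - 1) * real n) / (real n + 1)\<^sup>2"
      proof -
        have "2 ^ n * 2 powr (- (\<alpha> * real n)) = 2 powr (real n + - (\<alpha> * real n))"
          unfolding powr_add by (simp add: powr_realpow)
        also have "real n + - (\<alpha> * real n) = (\<beta> - 1) * real n"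
          by (simp add: \<alpha>_def algebra_simps)
        finally show ?thesis by (simp add: takagi_coeff_def)
      qed
      ultimately have "2 powr ((\<beta> - 1) * real n) / (real n + 1)\<^sup>2 \<le> 2 * C * 2 powr (real n * (\<gamma> - 1))"
        by simp
      also have "2 powr ((\<beta> - 1) * real n) = 2 powr ((\<beta> - \<gamma>) * real n) * 2 powr (real n * (\<gamma> - 1))"
        unfolding powr_add[symmetric] by (simp add: algebra_simps)
      finally have "2 powr ((\<beta> - \<gamma>) * real n) / (real n + 1)\<^sup>2 * 2 powr (real n * (\<gamma> - 1))
          \<le> 2 * C * 2 powr (real n * (\<gamma> - 1))"
        by (simp only: times_divide_eq_left)
      then show ?case by (rule mult_right_le_imp_le) simp
    qed
    \<comment> \<open>Exponential growth beats the square coming from the weights, because \<gamma>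
      < \<beta>.\<close>
    moreover have "filterlim (\<lambda>n. 2 powr ((\<beta> - \<gamma>) * real n) / (real n + 1)\<^sup>2) at_top sequentially"
      using \<gamma>(2) by real_asymp
    then have "eventually (\<lambda>n. 2 * C < 2 powr ((\<beta> - \<gamma>) * real n) / (real n + 1)\<^sup>2) sequentially"
      unfolding filterlim_at_top_dense by blast
    ultimately have "eventually (\<lambda>n::nat. False) sequentially" by eventually_elim simp
    then show False by simp
  qed
  show ?thesis using antisym[OF upper lower] unfolding g_def \<alpha>_def .
qed

subsection \<open>Factorization\<close>

lemma nonvanishing_constant_sign:
  fixes f :: "real \<Rightarrow> real"
  assumes "continuous_on {0..1} f" "\<And>x. x \<in> {0..1} \<Longrightarrow> f x \<noteq> 0"
  obtains s where "\<bar>s\<bar> = 1" "\<And>x. x \<in> {0..1} \<Longrightarrow> f x = s * \<bar>f x\<bar>"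
proof (cases "\<forall>x\<in>{0..1}. 0 < f x")
  case True
  then have "f x = 1 * \<bar>f x\<bar>" if "x \<in> {0..1}" for x
    using that abs_of_pos[of "f x"] by simp
  then show ?thesis by (rule that[rotated]) simp_all
next
  case False
  then obtain a where a: "a \<in> {0..1}" "f a \<le> 0" by force
  have "f x \<le> 0" if x: "x \<in> {0..1}" for x
  proof (rule ccontr)
    assume "\<not> f x \<le> 0"
    moreover have "connected (f ` {0..1})"
      using assms(1) by (intro connected_continuous_image) auto
    ultimately have "0 \<in> f ` {0..1}"
      using a x connectedD_interval[of "f ` {0..1}" "f a" "f x" 0] by auto
    then show False using assms(2) by force
  qed
  then have "f x = - 1 * \<bar>f x\<bar>" if "x \<in> {0..1}" for x
    using that abs_of_nonpos[of "f x"] by simp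
  then show ?thesis by (rule that[rotated]) simp_all
qed

text \<open>The square root is Lipschitz away from zero, so taking it does not raise the dimension.
  The two factors differ by a sign and have equal increments, and the product bound supplies the
  reverse inequality.\<close>

lemma upper_box_dim_sqrt_factorization:
  assumes f: "continuous_on {0..1} f" and nz: "\<And>x. x \<in> {0..1} \<Longrightarrow> f x \<noteq> 0"
  obtains g h where "continuous_on {0..1} g" "continuous_on {0..1} h"
    "\<And>x. x \<in> {0..1} \<Longrightarrow> f x = g x * h x"
    "upper_box_dim (graph01 g) = upper_box_dim (graph01 f)"
    "upper_box_dim (graph01 h) = upper_box_dim (graph01 f)"
proof -
  obtain s where s: "\<bar>s\<bar> = 1" "\<And>x. x \<in> {0..1} \<Longrightarrow> f x = s * \<bar>f x\<bar>"
    using nonvanishing_constant_sign[OF f nz] by metis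
  obtain m where m: "0 < m" "\<And>x. x \<in> {0..1} \<Longrightarrow> m \<le> \<bar>f x\<bar>"
    using continuous_on_abs_lower_bound[OF f nz] by metis
  define h where "h x = sqrt \<bar>f x\<bar>" for x
  define g where "g x = s * h x" for x
  have h: "continuous_on {0..1} h" unfolding h_def by (intro continuous_intros f)
  have g: "continuous_on {0..1} g" unfolding g_def by (intro continuous_intros h)
  have fgh: "f x = g x * h x" if "x \<in> {0..1}" for x
  proof -
    note s(2)[OF that]
    also have "s * \<bar>f x\<bar> = g x * h x" by (simp add: g_def h_def mult.assoc)
    finally show ?thesis .
  qed
  have hf: "upper_box_dim (graph01 h) \<le> upper_box_dim (graph01 f)"
  proof (rule upper_box_dim_le_of_increments[OF f h])
    fix x y :: real assume xy: "x \<in> {0..1}" "y \<in> {0..1}"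
    have lb: "sqrt m \<le> h x" "0 \<le> h x" "0 \<le> h y" using m(2)[OF xy(1)] by (auto simp: h_def)
    have sm: "0 < sqrt m" using m(1) by simp
    \<comment> \<open>Difference of squares; since h x + h y \<ge> sqrt m, dividing by it yields the
      Lipschitz constant 1 / sqrt m.\<close>
    have "(h x - h y) * (h x + h y) = \<bar>f x\<bar> - \<bar>f y\<bar>"
      by (simp add: h_def algebra_simps)
    moreover have "\<bar>(h x - h y) * (h x + h y)\<bar> = \<bar>h x - h y\<bar> * (h x + h y)"
      unfolding abs_mult using lb by (simp only: abs_of_nonneg add_nonneg_nonneg)
    ultimately have "\<bar>h x - h y\<bar> * (h x + h y) = \<bar>\<bar>f x\<bar> - \<bar>f y\<bar>\<bar>" by simp
    moreover have "\<bar>h x - h y\<bar> * sqrt m \<le> \<bar>h x - h y\<bar> * (h x + h y)"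
      using lb by (intro mult_left_mono) auto
    ultimately have "\<bar>h x - h y\<bar> * sqrt m \<le> \<bar>f x - f y\<bar>" by linarith
    then show "\<bar>h x - h y\<bar> \<le> 1 / sqrt m * \<bar>f x - f y\<bar>" using sm by (simp add: field_simps)
  qed (use m in simp)
  have gh: "\<bar>g x - g y\<bar> = \<bar>h x - h y\<bar>" for x y
    using s(1) by (simp add: g_def abs_mult flip: right_diff_distrib)
  have "upper_box_dim (graph01 g) \<le> upper_box_dim (graph01 h)"
    by (rule upper_box_dim_le_of_increments[OF h g, of 1]) (simp_all add: gh)
  moreover have "upper_box_dim (graph01 h) \<le> upper_box_dim (graph01 g)"
    by (rule upper_box_dim_le_of_increments[OF g h, of 1]) (simp_all add: gh)
  moreover have "upper_box_dim (graph01 f) \<le> max (upper_box_dim (graph01 g)) (upper_box_dim (graph01 h))"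
    by (rule upper_box_dim_mult_le[OF g h f fgh])
  ultimately have dims: "upper_box_dim (graph01 g) = upper_box_dim (graph01 f)"
    "upper_box_dim (graph01 h) = upper_box_dim (graph01 f)"
    using hf by auto
  show ?thesis by (rule that[OF g h _ dims]) (rule fgh)
qed

theorem theorem3p9:
  fixes \<beta> :: real and f :: "real \<Rightarrow> real"
  assumes "1 \<le> \<beta>" "\<beta> \<le> 2"
    and "continuous_on {0..1} f"
    and "\<forall>x\<in>{0..1}. f x \<noteq> 0"
  shows "(\<exists>g h. continuous_on {0..1} g \<and> continuous_on {0..1} h
            \<and> (\<forall>x\<in>{0..1}. f x = g x * h x)
            \<and> upper_box_dim (graph01 g) = ereal \<beta>
            \<and> upper_box_dim (graph01 h) = ereal \<beta>)
         \<longleftrightarrow> upper_box_dim (graph01 f) \<le> ereal \<beta>"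
    (is "?L \<longleftrightarrow> ?R")
proof
  assume ?L
  then obtain g h where g: "continuous_on {0..1} g" and h: "continuous_on {0..1} h"
    and fgh: "\<And>x. x \<in> {0..1} \<Longrightarrow> f x = g x * h x"
    and "upper_box_dim (graph01 g) = ereal \<beta>" "upper_box_dim (graph01 h) = ereal \<beta>" by blast
  then show ?R using upper_box_dim_mult_le[OF g h assms(3) fgh] by simp
next
  assume ?R
  show ?L
  proof (cases "upper_box_dim (graph01 f) = ereal \<beta>")
    case True
    obtain g h where "continuous_on {0..1} g" "continuous_on {0..1} h"
      "\<And>x. x \<in> {0..1} \<Longrightarrow> f x = g x * h x"
      "upper_box_dim (graph01 g) = upper_box_dim (graph01 f)"
      "upper_box_dim (graph01 h) = upper_box_dim (graph01 f)"
      using upper_box_dim_sqrt_factorization[OF assms(3)] assms(4) by metis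
    then show ?thesis using True by metis
  next
    case False
    then have less: "upper_box_dim (graph01 f) < ereal \<beta>" using \<open>?R\<close> by simp
    define g where "g = (\<lambda>x. 1 + takagi (2 - \<beta>) x)"
    define h where "h x = f x / g x" for x
    have \<alpha>: "0 \<le> 2 - \<beta>" using assms(2) by simp
    have dim_g: "upper_box_dim (graph01 g) = ereal \<beta>"
      unfolding g_def by (rule upper_box_dim_takagi[OF assms(1,2)])
    \<comment> \<open>The Takagi function is nonnegative, so the summand 1 keeps g at least
      1.\<close>
    have g0: "g x \<noteq> 0" for x using takagi_nonneg[OF \<alpha>, of x] by (simp add: g_def)
    have g: "continuous_on {0..1} g"
      unfolding g_def by (intro continuous_intros continuous_on_takagi \<alpha>)
    have h: "continuous_on {0..1} h"
      unfolding h_def using g0 by (intro continuous_intros g assms(3)) auto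
    have h0: "h x \<noteq> 0" if "x \<in> {0..1}" for x using assms(4) g0 that by (simp add: h_def)
    have "upper_box_dim (graph01 h) \<le> max (upper_box_dim (graph01 f)) (upper_box_dim (graph01 g))"
      by (rule upper_box_dim_divide_le[OF assms(3) g h g0 h_def])
    then have "upper_box_dim (graph01 h) \<le> ereal \<beta>" using \<open>?R\<close> dim_g by (simp add: max_absorb2)
    \<comment> \<open>Because f has dimension strictly below \<beta> while g = f / h has dimension
      \<beta>, the maximum can reach \<beta> only through h.\<close>
    moreover have "upper_box_dim (graph01 g) \<le> max (upper_box_dim (graph01 f)) (upper_box_dim (graph01 h))"
      by (rule upper_box_dim_divide_le[OF assms(3) h g h0]) (use assms(4) g0 in \<open>auto simp: h_def\<close>)
    then have "ereal \<beta> \<le> upper_box_dim (graph01 h)" using less by (simp add: dim_g le_max_iff_disj flip: not_less)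
    ultimately have "upper_box_dim (graph01 h) = ereal \<beta>" by (rule antisym)
    moreover have "\<forall>x\<in>{0..1}. f x = g x * h x" using g0 by (simp add: h_def)
    ultimately show ?thesis using g h dim_g by blast
  qed
qed

end
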